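(* Let $I$ be a homogeneous ideal in $(R,w)=(K[X,Y],(1,q_2))$. There exists a unique lexicographic ideal $L$ such that $H_{R/I}(t)=H_{R/L}(t)$ for every $t\in\mathbb N$.
   Context: $K$ is an infinite field of characteristic $0$, $q_2>1$ is an integer, and $R=K[X,Y]$ is graded by $\deg X=1$, $\deg Y=q_2$. $H_{R/J}(t)=\dim_K(R/J)_t$ denotes the Hilbert function. Monomials of the same degree are compared lexicographically with $X>Y$: $X^aY^b>X^{a'}Y^{b'}$ iff $a>a'$. A lexsegment of degree $d$ is a set $S$ of monomials of degree $d$ such that $u\in S$, $v>u$, $\deg v=\deg u$ imply $v\in S$. A monomial ideal is lexicographic if each of its graded components is spanned as a $K$-vector space by a (possibly empty) lexsegment. *)

theory Defs
  imports Complex_Main "HOL-Library.Poly_Mapping" "HOL-Library.Product_Plus"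
begin

text \<open>
  The ring \<open>K[X,Y]\<close> is the monoid ring of \<open>\<nat> \<times> \<nat>\<close> over \<open>K\<close>: the exponent pair \<open>(a, b)\<close>
  stands for the monomial \<open>X\<^sup>a Y\<^sup>b\<close>, and multiplication on \<^type>\<open>poly_mapping\<close> is convolution.
\<close>

type_synonym 'k bipoly = "(nat \<times> nat) \<Rightarrow>\<^sub>0 'k"

definition mono_XY :: "nat \<times> nat \<Rightarrow> 'k::field bipoly"
  where "mono_XY m = Poly_Mapping.single m 1"

definition kscale :: "'k::field \<Rightarrow> 'k bipoly \<Rightarrow> 'k bipoly"
  where "kscale c f = Poly_Mapping.single 0 c * f"

global_interpretation KV: vector_space "kscale :: 'k::field \<Rightarrow> 'k bipoly \<Rightarrow> 'k bipoly"
  by unfold_locales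
    (auto simp: kscale_def distrib_left distrib_right Poly_Mapping.single_add Poly_Mapping.mult_single
      simp flip: mult.assoc)

text \<open>
  \<open>R\<close> as a module over itself: ideals are its submodules (\<open>R.subspace\<close>), and the ideal generated
  by a set is its \<open>R\<close>-linear span (\<open>R.span\<close>).
\<close>

global_interpretation R: module "(*) :: 'k::field bipoly \<Rightarrow> 'k bipoly \<Rightarrow> 'k bipoly"
  by unfold_locales (auto simp: algebra_simps)

definition wdeg :: "nat \<Rightarrow> nat \<times> nat \<Rightarrow> nat"
  where "wdeg q m = fst m + q * snd m"

definition graded_part :: "nat \<Rightarrow> nat \<Rightarrow> 'k::field bipoly set"
  where "graded_part q d = {f. \<forall>m\<in>Poly_Mapping.keys f. wdeg q m = d}"

definition hom_component :: "nat \<Rightarrow> nat \<Rightarrow> 'k::field bipoly \<Rightarrow> 'k bipoly"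
  where "hom_component q d f =
    (\<Sum>m\<in>{m \<in> Poly_Mapping.keys f. wdeg q m = d}. Poly_Mapping.single m (Poly_Mapping.lookup f m))"

definition homogeneous_ideal :: "nat \<Rightarrow> 'k::field bipoly set \<Rightarrow> bool"
  where "homogeneous_ideal q I \<longleftrightarrow>
    R.subspace I \<and> (\<forall>f\<in>I. \<forall>d. hom_component q d f \<in> I)"

definition monomial_ideal :: "'k::field bipoly set \<Rightarrow> bool"
  where "monomial_ideal I \<longleftrightarrow> (\<exists>M. I = R.span (mono_XY ` M))"

text \<open>
  \<open>quot_basis V J B\<close>: the residue classes modulo \<open>J\<close> of the elements of \<open>B \<subseteq> V\<close> are pairwise
  distinct and form a finite \<open>K\<close>-basis of the image of \<open>V\<close> in \<open>R/J\<close>.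
\<close>

definition quot_basis :: "'k::field bipoly set \<Rightarrow> 'k bipoly set \<Rightarrow> 'k bipoly set \<Rightarrow> bool"
  where "quot_basis V J B \<longleftrightarrow>
    finite B \<and> B \<subseteq> V \<and>
    (\<forall>f\<in>V. \<exists>c. f - (\<Sum>b\<in>B. kscale (c b) b) \<in> J) \<and>
    (\<forall>c. (\<Sum>b\<in>B. kscale (c b) b) \<in> J \<longrightarrow> (\<forall>b\<in>B. c b = 0))"

text \<open>
  The dimension of \<open>(R/J)\<^sub>t\<close>, the image of \<open>R\<^sub>t\<close> in \<open>R/J\<close>.  For an ideal \<open>J\<close> and \<open>q > 0\<close> a basis
  exists and the choice does not matter, see \<open>quot_basis_exists\<close> and \<open>hilbert_eq_card\<close> below.
\<close>

definition hilbert :: "nat \<Rightarrow> 'k::field bipoly set \<Rightarrow> nat \<Rightarrow> nat"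
  where "hilbert q J t = card (SOME B. quot_basis (graded_part q t) J B)"

text \<open>
  \<open>X\<^sup>a Y\<^sup>b > X\<^sup>c Y\<^sup>d\<close> iff \<open>a > c\<close>; only used to compare monomials of the same degree.
\<close>

definition lex_greater :: "nat \<times> nat \<Rightarrow> nat \<times> nat \<Rightarrow> bool"
  where "lex_greater v u \<longleftrightarrow> fst v > fst u"

definition lexsegment :: "nat \<Rightarrow> nat \<Rightarrow> (nat \<times> nat) set \<Rightarrow> bool"
  where "lexsegment q d S \<longleftrightarrow>
    (\<forall>u\<in>S. wdeg q u = d) \<and>
    (\<forall>u v. u \<in> S \<and> lex_greater v u \<and> wdeg q v = wdeg q u \<longrightarrow> v \<in> S)"

definition lexicographic_ideal :: "nat \<Rightarrow> 'k::field bipoly set \<Rightarrow> bool"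
  where "lexicographic_ideal q L \<longleftrightarrow>
    monomial_ideal L \<and>
    (\<forall>d. \<exists>S. lexsegment q d S \<and> L \<inter> graded_part q d = KV.span (mono_XY ` S))"

lemma subspace_graded_part: "KV.subspace (graded_part q d :: 'k::field bipoly set)"
proof -
  have "Poly_Mapping.keys (kscale c f) \<subseteq> Poly_Mapping.keys f" for c and f :: "'k bipoly"
    using keys_mult[of "Poly_Mapping.single 0 c" f] by (auto simp: kscale_def zero_prod_def split: if_splits)
  then show ?thesis
    unfolding KV.subspace_def graded_part_def using keys_add by fastforce
qed

lemma graded_part_finite_span:
  assumes "q > 0"
  shows "\<exists>A. finite A \<and> (graded_part q d :: 'k::field bipoly set) \<subseteq> KV.span A"
proof (intro exI conjI)
  have "{m. wdeg q m = d} \<subseteq> {..d} \<times> {..d}"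
    using assms by (auto simp: wdeg_def trans_le_add2)
  then have "finite {m. wdeg q m = d}" by (rule finite_subset) simp
  then show "finite (mono_XY ` {m. wdeg q m = d} :: 'k bipoly set)" by simp
  show "(graded_part q d :: 'k bipoly set) \<subseteq> KV.span (mono_XY ` {m. wdeg q m = d})"
  proof
    fix f :: "'k bipoly" assume f: "f \<in> graded_part q d"
    have "f = (\<Sum>m\<in>Poly_Mapping.keys f. kscale (Poly_Mapping.lookup f m) (mono_XY m))"
      by (rule poly_mapping_eqI)
        (simp add: kscale_def mono_XY_def Poly_Mapping.mult_single lookup_sum lookup_single
          when_def sum.delta in_keys_iff)
    also have "\<dots> \<in> KV.span (mono_XY ` {m. wdeg q m = d})"
      using f by (intro KV.span_sum KV.span_scale KV.span_base) (auto simp: graded_part_def)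
    finally show "f \<in> KV.span (mono_XY ` {m. wdeg q m = d})" .
  qed
qed

lemma ideal_imp_KV_subspace: "R.subspace J \<Longrightarrow> KV.subspace J"
  by (auto simp: R.subspace_def KV.subspace_def kscale_def)

lemma sum_extend_coeffs:
  assumes "finite B" "A \<subseteq> B"
  shows "(\<Sum>b\<in>B. kscale (if b \<in> A then c b else 0) b) = (\<Sum>b\<in>A. kscale (c b) b)"
  using assms by (intro sum.mono_neutral_cong_right) auto

lemma quot_basis_exists:
  assumes "q > 0" and "R.subspace (J :: 'k::field bipoly set)"
  shows "\<exists>B. quot_basis (graded_part q t) J B"
proof -
  let ?V = "graded_part q t :: 'k bipoly set"
  have J: "KV.subspace J" using assms(2) by (rule ideal_imp_KV_subspace)
  obtain A :: "'k bipoly set" where A: "finite A" "?V \<subseteq> KV.span A"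
    using graded_part_finite_span assms(1) by blast
  obtain D where D: "D \<subseteq> J \<inter> ?V" "KV.independent D" "J \<inter> ?V \<subseteq> KV.span D"
    using KV.maximal_independent_subset by blast
  obtain E where E: "D \<subseteq> E" "E \<subseteq> ?V" "KV.independent E" "?V \<subseteq> KV.span E"
    using KV.maximal_independent_subset_extend[of D ?V] D by blast
  have finE: "finite E"
    using KV.independent_span_bound[OF A(1) E(3)] E(2) A(2) by blast
  have DV: "KV.span D \<subseteq> J" using D(1) J by (intro KV.span_minimal) auto
  have "quot_basis ?V J (E - D)"
    unfolding quot_basis_def
  proof (intro conjI ballI allI impI)
    show "finite (E - D)" "E - D \<subseteq> ?V" using finE E by auto
  next
    fix f assume "f \<in> ?V"
    then obtain c where c: "f = (\<Sum>b\<in>E. kscale (c b) b)"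
      using E(4) KV.span_finite[OF finE] by blast
    have "f - (\<Sum>b\<in>E - D. kscale (c b) b) = (\<Sum>b\<in>D. kscale (c b) b)"
      using c finE E(1) by (simp add: sum.subset_diff[of D E])
    also have "\<dots> \<in> KV.span D" by (intro KV.span_sum KV.span_scale KV.span_base)
    finally show "\<exists>c. f - (\<Sum>b\<in>E - D. kscale (c b) b) \<in> J" using DV by blast
  next
    fix c b assume s: "(\<Sum>b\<in>E - D. kscale (c b) b) \<in> J" and b: "b \<in> E - D"
    have "(\<Sum>b\<in>E - D. kscale (c b) b) \<in> ?V"
      using E(2) by (intro KV.subspace_sum subspace_graded_part KV.subspace_scale) auto
    with s D(3) have "(\<Sum>b\<in>E - D. kscale (c b) b) \<in> KV.span D" by blast
    moreover have finD: "finite D" using finE E(1) finite_subset by blast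
    ultimately obtain d where d: "(\<Sum>b\<in>E - D. kscale (c b) b) = (\<Sum>b\<in>D. kscale (d b) b)"
      using KV.span_finite by blast
    let ?e = "\<lambda>b. if b \<in> D then - d b else c b"
    have "(\<Sum>b\<in>E. kscale (?e b) b) = (\<Sum>b\<in>E - D. kscale (?e b) b) + (\<Sum>b\<in>D. kscale (?e b) b)"
      using finE E(1) by (rule sum.subset_diff[OF _ _, rotated])
    also have "\<dots> = (\<Sum>b\<in>E - D. kscale (c b) b) - (\<Sum>b\<in>D. kscale (d b) b)"
      by (simp add: sum_negf)
    finally have "(\<Sum>b\<in>E. kscale (?e b) b) = 0" using d by simp
    then have "?e b = 0"
      using KV.independentD[OF E(3) finE order_refl, of ?e b] b by blast
    then show "c b = 0" using b by auto
  qed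
  then show ?thesis by blast
qed

lemma quot_basis_card_le:
  assumes "q > 0" and "R.subspace (J :: 'k::field bipoly set)"
    and B: "quot_basis (graded_part q t) J B" and C: "quot_basis (graded_part q t) J C"
  shows "card B \<le> card C"
proof -
  let ?V = "graded_part q t :: 'k bipoly set"
  have J: "KV.subspace J" using assms(2) by (rule ideal_imp_KV_subspace)
  obtain A :: "'k bipoly set" where A: "finite A" "?V \<subseteq> KV.span A"
    using graded_part_finite_span assms(1) by blast
  obtain D where D: "D \<subseteq> J \<inter> ?V" "KV.independent D" "J \<inter> ?V \<subseteq> KV.span D"
    using KV.maximal_independent_subset by blast
  have finD: "finite D" using KV.independent_span_bound[OF A(1) D(2)] D(1) A(2) by blast
  have finB: "finite B" "B \<subseteq> ?V" and finC: "finite C" "C \<subseteq> ?V"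
    using B C by (auto simp: quot_basis_def)
  have indB: "\<forall>b\<in>B. c b = 0" if "(\<Sum>b\<in>B. kscale (c b) b) \<in> J" for c
    using B that unfolding quot_basis_def by blast
  have D_sum: "(\<Sum>b\<in>D. kscale (c b) b) \<in> J" for c
    using D(1) J by (intro KV.subspace_sum KV.subspace_scale) auto
  have disj: "B \<inter> D = {}"
  proof (rule ccontr)
    assume "B \<inter> D \<noteq> {}"
    then obtain b where b: "b \<in> B" "b \<in> D" by blast
    have "(\<Sum>x\<in>B. kscale (if x \<in> {b} then 1 else 0) x) = (\<Sum>x\<in>{b}. kscale 1 x)"
      using finB(1) b(1) by (intro sum_extend_coeffs) auto
    also have "\<dots> = b" by simp
    also have "b \<in> J" using b D(1) by blast
    finally show False using indB b(1) by fastforce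
  qed
  have ind: "KV.independent (B \<union> D)"
  proof (rule KV.independent_if_scalars_zero)
    show "finite (B \<union> D)" using finB finD by simp
    fix c x assume s: "(\<Sum>b\<in>B \<union> D. kscale (c b) b) = 0" and x: "x \<in> B \<union> D"
    have s': "(\<Sum>b\<in>B. kscale (c b) b) + (\<Sum>b\<in>D. kscale (c b) b) = 0"
      using s disj finB finD by (simp add: sum.union_disjoint)
    then have "(\<Sum>b\<in>B. kscale (c b) b) = - (\<Sum>b\<in>D. kscale (c b) b)"
      by (simp add: eq_neg_iff_add_eq_0)
    also have "\<dots> \<in> J" using D_sum J by (intro KV.subspace_neg)
    finally have cB: "\<forall>b\<in>B. c b = 0" by (rule indB)
    then have "(\<Sum>b\<in>D. kscale (c b) b) = 0" using s' by simp
    then have "\<forall>b\<in>D. c b = 0" using KV.independentD[OF D(2) finD order_refl] by blast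
    with cB x show "c x = 0" by blast
  qed
  have "B \<union> D \<subseteq> KV.span (C \<union> D)"
  proof
    fix f assume "f \<in> B \<union> D"
    then have f: "f \<in> ?V" using finB D(1) by blast
    obtain c where c: "f - (\<Sum>b\<in>C. kscale (c b) b) \<in> J"
      using C f unfolding quot_basis_def by blast
    have "(\<Sum>b\<in>C. kscale (c b) b) \<in> ?V"
      using finC(2) by (intro KV.subspace_sum subspace_graded_part KV.subspace_scale) auto
    then have "f - (\<Sum>b\<in>C. kscale (c b) b) \<in> J \<inter> ?V"
      using c f KV.subspace_diff[OF subspace_graded_part] by blast
    then have "f - (\<Sum>b\<in>C. kscale (c b) b) \<in> KV.span (C \<union> D)"
      using D(3) KV.span_mono[of D "C \<union> D"] by blast
    moreover have "(\<Sum>b\<in>C. kscale (c b) b) \<in> KV.span (C \<union> D)"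
      by (intro KV.span_sum KV.span_scale KV.span_base) simp
    ultimately have "f - (\<Sum>b\<in>C. kscale (c b) b) + (\<Sum>b\<in>C. kscale (c b) b) \<in> KV.span (C \<union> D)"
      by (rule KV.span_add)
    then show "f \<in> KV.span (C \<union> D)" by simp
  qed
  then have "card (B \<union> D) \<le> card (C \<union> D)"
    using KV.independent_span_bound[OF _ ind] finC finD by blast
  also have "\<dots> \<le> card C + card D" by (rule card_Un_le)
  finally show ?thesis using card_Un_disjoint[OF finB(1) finD disj] by simp
qed

lemma hilbert_eq_card:
  assumes "q > 0" and "R.subspace (J :: 'k::field bipoly set)"
    and "quot_basis (graded_part q t) J B"
  shows "hilbert q J t = card B"
  unfolding hilbert_def
  using someI[of "quot_basis (graded_part q t) J", OF assms(3)] assms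
  by (intro antisym quot_basis_card_le)

end

theory Submission
  imports Defs
begin

text \<open>
  Write \<open>q\<close> for the weight of \<open>Y\<close>.  In degree \<open>d\<close> the monomials are \<open>X\<^sup>d > X\<^bsup>d-q\<^esup>Y > X\<^bsup>d-2q\<^esup>Y\<^sup>2 > \<dots>\<close>, so a lexsegment is determined by its
  size, and the only possible \<open>L\<close> is the one whose degree \<open>d\<close> part is spanned by the first
  \<open>h d = dim I\<^sub>d\<close> of these monomials.  The question is whether these spaces form an ideal.
  Multiplying by \<open>X\<close> keeps the exponent of \<open>Y\<close>, so it requires \<open>h d \<le> h (d + 1)\<close>.  Multiplying by \<open>Y\<close>
  raises that exponent by one, so it requires \<open>h d + 1 \<le> h (d + q)\<close> whenever \<open>h d > 0\<close>.

  Both inequalities are read off from leading monomials, where ``leading'' means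
  ``of largest exponent of \<open>Y\<close>''.  Monomials that do not lead any element of \<open>I\<^sub>d\<close> give a basis of
  \<open>(R/I)\<^sub>d\<close> (\<open>quot_basis_standard\<close>), so \<open>h d\<close> is the number of leading monomials in degree \<open>d\<close>, and the
  Hilbert function of \<open>R/I\<close> determines it (\<open>hilbert_plus_card_leading\<close>).  Multiplication by a
  monomial translates leading monomials.  Multiplication by \<open>X\<close> thus gives the first
  inequality.  For the second, the translates by \<open>X\<^sup>q\<close> realise in degree \<open>d + q\<close> all the
  \<open>Y\<close>-exponents of degree \<open>d\<close>, and the translate by \<open>Y\<close> of the leading monomial with the largest
  \<open>Y\<close>-exponent adds one more (\<open>card_leading_Y\<close>).
\<close>

section \<open>Polynomials as combinations of monomials\<close>

lemma lookup_kscale: "Poly_Mapping.lookup (kscale c f) m = c * Poly_Mapping.lookup f m"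
proof -
  have f: "f = (\<Sum>n\<in>Poly_Mapping.keys f. Poly_Mapping.single n (Poly_Mapping.lookup f n))"
    by (rule poly_mapping_eqI)
      (simp add: lookup_sum lookup_single when_def sum.delta in_keys_iff)
  have "kscale c f = (\<Sum>n\<in>Poly_Mapping.keys f. Poly_Mapping.single n (c * Poly_Mapping.lookup f n))"
    by (subst f) (simp add: kscale_def sum_distrib_left Poly_Mapping.mult_single)
  then show ?thesis
    by (simp add: lookup_sum lookup_single when_def sum.delta in_keys_iff)
qed

lemma lookup_mono_XY_mult:
  "Poly_Mapping.lookup (mono_XY n * f) (n + m) = Poly_Mapping.lookup f m"
proof -
  have f: "f = (\<Sum>k\<in>Poly_Mapping.keys f. Poly_Mapping.single k (Poly_Mapping.lookup f k))"
    by (rule poly_mapping_eqI)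
      (simp add: lookup_sum lookup_single when_def sum.delta in_keys_iff)
  have "mono_XY n * f = (\<Sum>k\<in>Poly_Mapping.keys f. Poly_Mapping.single (n + k) (Poly_Mapping.lookup f k))"
    by (subst f) (simp add: mono_XY_def sum_distrib_left Poly_Mapping.mult_single)
  then show ?thesis
    by (simp add: lookup_sum lookup_single when_def sum.delta in_keys_iff)
qed

lemma keys_mono_XY [simp]: "Poly_Mapping.keys (mono_XY m :: 'k::field bipoly) = {m}"
  by (simp add: mono_XY_def)

lemma keys_mono_XY_mult_subset:
  "Poly_Mapping.keys (mono_XY n * f) \<subseteq> (+) n ` Poly_Mapping.keys (f :: 'k::field bipoly)"
  using keys_mult[of "mono_XY n" f] unfolding keys_mono_XY by blast

lemma lookup_sum_mono_XY:
  assumes "finite M"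
  shows "Poly_Mapping.lookup (\<Sum>m\<in>M. kscale (c m) (mono_XY m)) n = (if n \<in> M then c n else 0)"
  using assms
  by (simp add: lookup_sum lookup_kscale mono_XY_def lookup_single when_def if_distrib sum.delta
      cong: if_cong)

lemma bipoly_expansion:
  assumes "finite M" "Poly_Mapping.keys f \<subseteq> M"
  shows "f = (\<Sum>m\<in>M. kscale (Poly_Mapping.lookup f m) (mono_XY m))"
  using assms by (intro poly_mapping_eqI) (auto simp: lookup_sum_mono_XY in_keys_iff)

lemma inj_mono_XY: "inj (mono_XY :: _ \<Rightarrow> 'k::field bipoly)"
  by (rule injI) (metis keys_mono_XY singleton_inject)

lemma KV_span_mono_XY: "KV.span (mono_XY ` S) = {f :: 'k::field bipoly. Poly_Mapping.keys f \<subseteq> S}"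
proof
  have "KV.subspace {f :: 'k bipoly. Poly_Mapping.keys f \<subseteq> S}"
    unfolding KV.subspace_def
  proof (intro conjI ballI allI)
    show "x + y \<in> {f. Poly_Mapping.keys f \<subseteq> S}"
      if "x \<in> {f. Poly_Mapping.keys f \<subseteq> S}" "y \<in> {f. Poly_Mapping.keys f \<subseteq> S}" for x y :: "'k bipoly"
      using that keys_add[of x y] by blast
    show "kscale c x \<in> {f. Poly_Mapping.keys f \<subseteq> S}"
      if "x \<in> {f. Poly_Mapping.keys f \<subseteq> S}" for c and x :: "'k bipoly"
      using that by (auto simp: lookup_kscale in_keys_iff)
  qed simp
  then show "KV.span (mono_XY ` S) \<subseteq> {f :: 'k bipoly. Poly_Mapping.keys f \<subseteq> S}"
    by (intro KV.span_minimal) auto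
  show "{f :: 'k bipoly. Poly_Mapping.keys f \<subseteq> S} \<subseteq> KV.span (mono_XY ` S)"
  proof
    fix f :: "'k bipoly" assume f: "f \<in> {f. Poly_Mapping.keys f \<subseteq> S}"
    have "(\<Sum>m\<in>Poly_Mapping.keys f. kscale (Poly_Mapping.lookup f m) (mono_XY m))
        \<in> KV.span (mono_XY ` S)"
      using f by (intro KV.span_sum KV.span_scale KV.span_base) auto
    then show "f \<in> KV.span (mono_XY ` S)"
      using bipoly_expansion[of "Poly_Mapping.keys f" f] by simp
  qed
qed

lemma R_span_mono_XY:
  assumes "\<And>m n. m \<in> M \<Longrightarrow> n + m \<in> M"
  shows "R.span (mono_XY ` M) = {f :: 'k::field bipoly. Poly_Mapping.keys f \<subseteq> M}"
proof
  have "Poly_Mapping.keys (g * f) \<subseteq> M" if "Poly_Mapping.keys f \<subseteq> M" for f g :: "'k bipoly"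
    using keys_mult[of g f] that assms by blast
  moreover have "Poly_Mapping.keys (f + g) \<subseteq> M"
    if "Poly_Mapping.keys f \<subseteq> M" "Poly_Mapping.keys g \<subseteq> M" for f g :: "'k bipoly"
    using keys_add[of f g] that by blast
  ultimately have "R.subspace {f :: 'k bipoly. Poly_Mapping.keys f \<subseteq> M}"
    by (simp add: R.subspace_def)
  then show "R.span (mono_XY ` M) \<subseteq> {f :: 'k bipoly. Poly_Mapping.keys f \<subseteq> M}"
    by (intro R.span_minimal) auto
  have "KV.span (mono_XY ` M) \<subseteq> R.span (mono_XY ` M :: 'k bipoly set)"
    by (intro KV.span_minimal ideal_imp_KV_subspace R.subspace_span R.span_superset)
  then show "{f :: 'k bipoly. Poly_Mapping.keys f \<subseteq> M} \<subseteq> R.span (mono_XY ` M)"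
    by (simp add: KV_span_mono_XY)
qed

section \<open>Monomials of a given weighted degree\<close>

definition exps_of_degree :: "nat \<Rightarrow> nat \<Rightarrow> (nat \<times> nat) set"
  where "exps_of_degree q d = {m. wdeg q m = d}"

lemma wdeg_add: "wdeg q (m + n) = wdeg q m + wdeg q n"
  by (simp add: wdeg_def algebra_simps)

lemma exp_eqI: "wdeg q m = wdeg q n \<Longrightarrow> snd m = snd n \<Longrightarrow> m = n"
  by (simp add: wdeg_def prod_eq_iff)

lemma inj_on_snd_exps_of_degree: "inj_on snd (exps_of_degree q d)"
  by (rule inj_onI) (simp add: exps_of_degree_def exp_eqI[of q])

lemma snd_exps_of_degree:
  assumes "q > 0"
  shows "snd ` exps_of_degree q d = {..d div q}"
proof
  show "snd ` exps_of_degree q d \<subseteq> {..d div q}"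
    using assms by (auto simp: exps_of_degree_def wdeg_def less_eq_div_iff_mult_less_eq ac_simps)
  show "{..d div q} \<subseteq> snd ` exps_of_degree q d"
  proof
    fix b assume "b \<in> {..d div q}"
    then have "b * q \<le> d" using assms by (simp add: less_eq_div_iff_mult_less_eq)
    then have "(d - q * b, b) \<in> exps_of_degree q d"
      by (simp add: exps_of_degree_def wdeg_def ac_simps)
    then show "b \<in> snd ` exps_of_degree q d" by force
  qed
qed

lemma finite_exps_of_degree: "q > 0 \<Longrightarrow> finite (exps_of_degree q d)"
  using finite_imageD[OF _ inj_on_snd_exps_of_degree] by (simp add: snd_exps_of_degree)

lemma graded_part_eq: "graded_part q d = {f. Poly_Mapping.keys f \<subseteq> exps_of_degree q d}"
  by (auto simp: graded_part_def exps_of_degree_def)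

section \<open>Leading exponents and the Hilbert function\<close>

definition leading_exps :: "nat \<Rightarrow> 'k::field bipoly set \<Rightarrow> nat \<Rightarrow> (nat \<times> nat) set"
  where "leading_exps q J d =
    {m. \<exists>f\<in>J \<inter> graded_part q d. m \<in> Poly_Mapping.keys f \<and> (\<forall>n\<in>Poly_Mapping.keys f. snd n \<le> snd m)}"

lemma leading_exps_subset: "leading_exps q J d \<subseteq> exps_of_degree q d"
  by (auto simp: leading_exps_def graded_part_eq)

text \<open>
  This is division with remainder: cancel the offending terms of \<open>f\<close> one at a time, starting with the one of largest
  \<open>Y\<close>-exponent.  Cancelling a term only changes terms of smaller \<open>Y\<close>-exponent, because a degree
  contains at most one monomial for each \<open>Y\<close>-exponent.
\<close>

lemma reduce_to_standard:
  fixes J :: "'k::field bipoly set"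
  assumes J: "R.subspace J"
    and "f \<in> graded_part q t"
    and "\<And>m. m \<in> Poly_Mapping.keys f \<Longrightarrow> m \<in> leading_exps q J t \<Longrightarrow> snd m < n"
  shows "\<exists>g\<in>graded_part q t. Poly_Mapping.keys g \<inter> leading_exps q J t = {} \<and> f - g \<in> J"
  using assms(2,3)
proof (induction n arbitrary: f)
  case 0
  then have "Poly_Mapping.keys f \<inter> leading_exps q J t = {}" by blast
  with 0(1) show ?case using R.subspace_0[OF J] by force
next
  case (Suc n)
  note JK = ideal_imp_KV_subspace[OF J]
  show ?case
  proof (cases "\<exists>m\<in>Poly_Mapping.keys f \<inter> leading_exps q J t. snd m = n")
    case False
    have "snd m < n" if "m \<in> Poly_Mapping.keys f" "m \<in> leading_exps q J t" for m
    proof -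
      have "snd m \<noteq> n" using that False by blast
      then show ?thesis using Suc.prems(2)[OF that] by simp
    qed
    then show ?thesis by (rule Suc.IH[OF Suc.prems(1)])
  next
    case True
    then obtain m where m: "m \<in> Poly_Mapping.keys f" "m \<in> leading_exps q J t" "snd m = n" by blast
    then obtain p where p: "p \<in> J" "p \<in> graded_part q t" "m \<in> Poly_Mapping.keys p"
      "\<And>k. k \<in> Poly_Mapping.keys p \<Longrightarrow> snd k \<le> n"
      unfolding leading_exps_def by blast
    define c where "c = Poly_Mapping.lookup f m / Poly_Mapping.lookup p m"
    define f' where "f' = f - kscale c p"
    have f': "Poly_Mapping.lookup f' k = Poly_Mapping.lookup f k - c * Poly_Mapping.lookup p k" for k
      by (simp add: f'_def lookup_minus lookup_kscale)
    have cp: "kscale c p \<in> J" using JK p(1) by (rule KV.subspace_scale)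
    have "f' \<in> graded_part q t"
      unfolding f'_def
      using Suc.prems(1) p(2)
      by (intro KV.subspace_diff KV.subspace_scale subspace_graded_part)
    moreover have "snd k < n" if k: "k \<in> Poly_Mapping.keys f'" "k \<in> leading_exps q J t" for k
    proof (rule ccontr)
      assume "\<not> snd k < n"
      then consider "snd k = n" | "snd k > n" by linarith
      then show False
      proof cases
        case 1
        have "k = m"
          using k(2) m(2,3) 1 leading_exps_subset[of q J t]
          by (intro exp_eqI[of q]) (auto simp: exps_of_degree_def)
        then show False using k(1) p(3) f'[of m] by (simp add: c_def in_keys_iff)
      next
        case 2
        then have "k \<notin> Poly_Mapping.keys p" using p(4)[of k] by auto
        then have "k \<in> Poly_Mapping.keys f" using k(1) f'[of k] by (simp add: in_keys_iff)
        then show False using Suc.prems(2)[of k] k(2) 2 by simp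
      qed
    qed
    ultimately obtain g where g: "g \<in> graded_part q t"
      "Poly_Mapping.keys g \<inter> leading_exps q J t = {}" "f' - g \<in> J"
      using Suc.IH[of f'] by blast
    have "f - g = (f' - g) + kscale c p" by (simp add: f'_def)
    then have "f - g \<in> J" using R.subspace_add[OF J g(3) cp] by argo
    with g show ?thesis by blast
  qed
qed

text \<open>
  The standard monomials are independent modulo \<open>J\<close> because a nonzero combination of them that
  lies in \<open>J\<close> would have a standard monomial as its leading monomial.
\<close>

lemma quot_basis_standard:
  fixes J :: "'k::field bipoly set"
  assumes q: "q > 0" and J: "R.subspace J"
  shows "quot_basis (graded_part q t) J (mono_XY ` (exps_of_degree q t - leading_exps q J t))"
proof -
  let ?S = "exps_of_degree q t - leading_exps q J t"
  have fin: "finite ?S" using finite_exps_of_degree[OF q] by simp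
  have reindex: "(\<Sum>b\<in>mono_XY ` ?S. kscale (c b) b) = (\<Sum>m\<in>?S. kscale (c (mono_XY m)) (mono_XY m))"
    for c :: "'k bipoly \<Rightarrow> 'k"
    by (subst sum.reindex) (auto intro: inj_on_subset[OF inj_mono_XY])
  show ?thesis
    unfolding quot_basis_def
  proof (intro conjI ballI allI impI)
    show "finite (mono_XY ` ?S)" using fin by simp
    show "mono_XY ` ?S \<subseteq> (graded_part q t :: 'k bipoly set)" by (auto simp: graded_part_eq)
  next
    fix f :: "'k bipoly" assume f: "f \<in> graded_part q t"
    have "snd m < Suc (t div q)" if "m \<in> leading_exps q J t" for m
      using that leading_exps_subset[of q J t] snd_exps_of_degree[OF q, of t]
      by (fastforce simp: less_Suc_eq_le)
    then obtain g where g: "g \<in> graded_part q t" "Poly_Mapping.keys g \<inter> leading_exps q J t = {}"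
      "f - g \<in> J"
      using reduce_to_standard[OF J f] by blast
    have "g = (\<Sum>m\<in>?S. kscale (Poly_Mapping.lookup g m) (mono_XY m))"
      using g(1,2) by (intro bipoly_expansion fin) (auto simp: graded_part_eq)
    also have "\<dots> = (\<Sum>b\<in>mono_XY ` ?S. kscale (Poly_Mapping.lookup g (inv mono_XY b)) b)"
      by (simp add: reindex inv_f_f[OF inj_mono_XY])
    finally have "f - (\<Sum>b\<in>mono_XY ` ?S. kscale (Poly_Mapping.lookup g (inv mono_XY b)) b) \<in> J"
      using g(3) by argo
    then show "\<exists>c. f - (\<Sum>b\<in>mono_XY ` ?S. kscale (c b) b) \<in> J"
      by (rule exI[of _ "\<lambda>b :: 'k bipoly. Poly_Mapping.lookup g (inv mono_XY b)"])
  next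
    fix c :: "'k bipoly \<Rightarrow> 'k" and b :: "'k bipoly"
    assume s: "(\<Sum>b\<in>mono_XY ` ?S. kscale (c b) b) \<in> J" and b: "b \<in> mono_XY ` ?S"
    define f where "f = (\<Sum>m\<in>?S. kscale (c (mono_XY m)) (mono_XY m))"
    have lookup_f: "Poly_Mapping.lookup f m = (if m \<in> ?S then c (mono_XY m) else 0)" for m
      unfolding f_def by (rule lookup_sum_mono_XY[OF fin])
    have keys_f: "Poly_Mapping.keys f \<subseteq> ?S"
      by (auto simp: in_keys_iff lookup_f split: if_splits)
    have fJ: "f \<in> J \<inter> graded_part q t"
      using s keys_f by (auto simp: reindex f_def graded_part_eq)
    have "Poly_Mapping.keys f = {}"
    proof (rule ccontr)
      assume ne: "Poly_Mapping.keys f \<noteq> {}"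
      then have "Max (snd ` Poly_Mapping.keys f) \<in> snd ` Poly_Mapping.keys f"
        by (intro Max_in) auto
      then obtain m where m: "m \<in> Poly_Mapping.keys f" "snd m = Max (snd ` Poly_Mapping.keys f)"
        by auto
      then have "\<forall>n\<in>Poly_Mapping.keys f. snd n \<le> snd m" by simp
      with fJ m(1) have "m \<in> leading_exps q J t" unfolding leading_exps_def by blast
      then show False using m(1) keys_f by blast
    qed
    moreover obtain m where "m \<in> ?S" "b = mono_XY m" using b by blast
    ultimately show "c b = 0" using lookup_f[of m] by simp
  qed
qed

lemma hilbert_plus_card_leading:
  fixes J :: "'k::field bipoly set"
  assumes q: "q > 0" and J: "R.subspace J"
  shows "hilbert q J t + card (leading_exps q J t) = card (exps_of_degree q t)"
proof -
  let ?E = "exps_of_degree q t" and ?L = "leading_exps q J t"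
  have "hilbert q J t = card (mono_XY ` (?E - ?L) :: 'k bipoly set)"
    by (rule hilbert_eq_card[OF q J quot_basis_standard[OF q J]])
  also have "\<dots> = card (?E - ?L)"
    by (intro card_image inj_on_subset[OF inj_mono_XY]) simp
  finally show ?thesis
    using finite_exps_of_degree[OF q] leading_exps_subset[of q J t]
    by (simp add: card_Diff_subset finite_subset card_mono)
qed

text \<open>
  For a lexicographic \<open>L\<close> this identifies the leading exponents with the lexsegment itself, so that
  the preceding count gives the size of the lexsegment.
\<close>

lemma leading_exps_monomial_span:
  fixes J :: "'k::field bipoly set"
  assumes "J \<inter> graded_part q d = KV.span (mono_XY ` S)"
  shows "leading_exps q J d = S"
proof -
  have J: "J \<inter> graded_part q d = {f. Poly_Mapping.keys f \<subseteq> S}"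
    using assms by (simp add: KV_span_mono_XY)
  have "m \<in> leading_exps q J d" if "m \<in> S" for m
    using that unfolding leading_exps_def J by (auto intro!: exI[of _ "mono_XY m"])
  then show ?thesis unfolding leading_exps_def J by blast
qed

section \<open>Growth of the leading exponents\<close>

text \<open>
  Multiplying by a monomial shifts all \<open>Y\<close>-exponents by the same amount, so it preserves
  which of them is the largest.
\<close>

lemma leading_exps_translate:
  fixes J :: "'k::field bipoly set"
  assumes J: "R.subspace J" and m: "m \<in> leading_exps q J d"
  shows "n + m \<in> leading_exps q J (wdeg q n + d)"
proof -
  obtain f where f: "f \<in> J" "f \<in> graded_part q d" "m \<in> Poly_Mapping.keys f"
    "\<forall>k\<in>Poly_Mapping.keys f. snd k \<le> snd m"
    using m unfolding leading_exps_def by blast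
  let ?g = "mono_XY n * f"
  have "?g \<in> J" using J f(1) by (rule R.subspace_scale)
  moreover have "?g \<in> graded_part q (wdeg q n + d)"
    using f(2) keys_mono_XY_mult_subset[of n f] by (fastforce simp: graded_part_def wdeg_add)
  moreover have "n + m \<in> Poly_Mapping.keys ?g"
    using f(3) by (simp add: in_keys_iff lookup_mono_XY_mult)
  moreover have "\<forall>k\<in>Poly_Mapping.keys ?g. snd k \<le> snd (n + m)"
    using f(4) keys_mono_XY_mult_subset[of n f] by fastforce
  ultimately show ?thesis unfolding leading_exps_def by blast
qed

lemma finite_leading_exps: "q > 0 \<Longrightarrow> finite (leading_exps q J d)"
  using finite_subset[OF leading_exps_subset finite_exps_of_degree] .

lemma card_leading_X:
  fixes J :: "'k::field bipoly set"
  assumes q: "q > 0" and J: "R.subspace J"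
  shows "card (leading_exps q J d) \<le> card (leading_exps q J (d + k))"
proof (rule card_inj_on_le)
  show "inj_on ((+) (k, 0)) (leading_exps q J d)" by simp
  show "(+) (k, 0) ` leading_exps q J d \<subseteq> leading_exps q J (d + k)"
    using leading_exps_translate[OF J, of _ q d "(k, 0)"] by (auto simp: wdeg_def add.commute)
  show "finite (leading_exps q J (d + k))" by (rule finite_leading_exps[OF q])
qed

text \<open>
  Let \<open>m\<close> have the largest \<open>Y\<close>-exponent in degree \<open>d\<close>.  The translates by \<open>X\<^sup>q\<close> never exceed
  this exponent, while \<open>Y\<close> times the monomial of \<open>m\<close> does, and both kinds lie in degree \<open>d + q\<close>.
\<close>

lemma card_leading_Y:
  fixes J :: "'k::field bipoly set"
  assumes q: "q > 0" and J: "R.subspace J" and ne: "leading_exps q J d \<noteq> {}"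
  shows "Suc (card (leading_exps q J d)) \<le> card (leading_exps q J (d + q))"
proof -
  let ?A = "leading_exps q J d"
  have fin: "finite ?A" by (rule finite_leading_exps[OF q])
  obtain m where m: "m \<in> ?A" "\<And>n. n \<in> ?A \<Longrightarrow> snd n \<le> snd m"
  proof -
    have "Max (snd ` ?A) \<in> snd ` ?A" using fin ne by (intro Max_in) auto
    then obtain m where "m \<in> ?A" "snd m = Max (snd ` ?A)" by auto
    then show ?thesis using that fin by simp
  qed
  let ?B = "insert ((0, 1) + m) ((+) (q, 0) ` ?A)"
  have "?B \<subseteq> leading_exps q J (d + q)"
    using leading_exps_translate[OF J, of _ q d "(q, 0)"]
      leading_exps_translate[OF J m(1), of "(0, 1)"]
    by (auto simp: wdeg_def add.commute)
  then have "card ?B \<le> card (leading_exps q J (d + q))"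
    by (intro card_mono finite_leading_exps[OF q])
  moreover have "(0, 1) + m \<notin> (+) (q, 0) ` ?A"
    using m(2) by (fastforce simp: prod_eq_iff)
  then have "card ?B = Suc (card ?A)" using fin by (simp add: card_image)
  ultimately show ?thesis by simp
qed

section \<open>Lexsegments and lexicographic ideals\<close>

lemma lexsegmentD:
  "lexsegment q d S \<Longrightarrow> u \<in> S \<Longrightarrow> fst v > fst u \<Longrightarrow> wdeg q v = wdeg q u \<Longrightarrow> v \<in> S"
  unfolding lexsegment_def lex_greater_def by blast

text \<open>
  Lexsegments of the same degree are nested, since that degree is linearly ordered.
\<close>

lemma lexsegment_unique:
  assumes q: "q > 0" and S: "lexsegment q d S" and T: "lexsegment q d T" and card: "card S = card T"
  shows "S = T"
proof -
  have sub: "S \<subseteq> exps_of_degree q d" "T \<subseteq> exps_of_degree q d"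
    using S T unfolding lexsegment_def exps_of_degree_def by blast+
  have fin: "finite S" "finite T"
    using sub by (auto intro: finite_subset[OF _ finite_exps_of_degree[OF q]])
  have "S \<subseteq> T \<or> T \<subseteq> S"
  proof (rule ccontr)
    assume "\<not> (S \<subseteq> T \<or> T \<subseteq> S)"
    then obtain u v where u: "u \<in> S" "u \<notin> T" and v: "v \<in> T" "v \<notin> S" by blast
    have deg: "wdeg q u = d" "wdeg q v = d" using u(1) v(1) S T unfolding lexsegment_def by blast+
    have "\<not> fst v > fst u"
      using lexsegmentD[OF S u(1), of v] v(2) deg by metis
    moreover have "\<not> fst u > fst v"
      using lexsegmentD[OF T v(1), of u] u(2) deg by metis
    ultimately have fst_eq: "fst u = fst v" by simp
    then have "q * snd u = q * snd v" using deg unfolding wdeg_def by linarith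
    then have "u = v" using fst_eq q by (simp add: prod_eq_iff)
    then show False using u v by blast
  qed
  then show ?thesis using fin card card_subset_eq by metis
qed

lemma monomial_ideal_subspace: "monomial_ideal L \<Longrightarrow> R.subspace L"
  by (auto simp: monomial_ideal_def)

text \<open>
  The generating monomials are homogeneous, so a monomial ideal is determined by its graded parts.
\<close>

lemma monomial_ideal_subsetI:
  fixes L L' :: "'k::field bipoly set"
  assumes "monomial_ideal L" and L': "R.subspace L'"
    and sub: "\<And>d. L \<inter> graded_part q d \<subseteq> L'"
  shows "L \<subseteq> L'"
proof -
  obtain M where L: "L = R.span (mono_XY ` M)" using assms(1) by (auto simp: monomial_ideal_def)
  have "mono_XY m \<in> L'" if "m \<in> M" for m
  proof -
    have "mono_XY m \<in> L" using that unfolding L by (intro R.span_base) simp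
    moreover have "mono_XY m \<in> (graded_part q (wdeg q m) :: 'k bipoly set)"
      by (simp add: graded_part_def)
    ultimately show ?thesis using sub by blast
  qed
  then show ?thesis unfolding L using L' by (intro R.span_minimal) auto
qed

lemma lexicographic_ideal_unique:
  fixes L L' :: "'k::field bipoly set"
  assumes q: "q > 0" and L: "lexicographic_ideal q L" and L': "lexicographic_ideal q L'"
    and H: "\<And>t. hilbert q L t = hilbert q L' t"
  shows "L = L'"
proof -
  have mon: "monomial_ideal L" "monomial_ideal L'" using L L' by (auto simp: lexicographic_ideal_def)
  have "L \<inter> graded_part q d = L' \<inter> graded_part q d" for d
  proof -
    obtain S where S: "lexsegment q d S" "L \<inter> graded_part q d = KV.span (mono_XY ` S)"
      using L by (auto simp: lexicographic_ideal_def)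
    obtain T where T: "lexsegment q d T" "L' \<inter> graded_part q d = KV.span (mono_XY ` T)"
      using L' by (auto simp: lexicographic_ideal_def)
    have "card (leading_exps q L d) = card (leading_exps q L' d)"
      using hilbert_plus_card_leading[OF q monomial_ideal_subspace[OF mon(1)], of d]
        hilbert_plus_card_leading[OF q monomial_ideal_subspace[OF mon(2)], of d] H[of d]
      by simp
    then have "card S = card T" using S(2) T(2) by (simp add: leading_exps_monomial_span)
    then have "S = T" using lexsegment_unique[OF q S(1) T(1)] by simp
    with S(2) T(2) show ?thesis by simp
  qed
  then show ?thesis
    using monomial_ideal_subsetI[OF mon(1) monomial_ideal_subspace[OF mon(2)], of q]
      monomial_ideal_subsetI[OF mon(2) monomial_ideal_subspace[OF mon(1)], of q]
    by blast
qed

text \<open>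
  The two growth conditions make the set of exponents \<open>(a, b)\<close> with \<open>b < h (a + q b)\<close> closed
  under multiplication by \<open>X\<close> and by \<open>Y\<close>, so its monomials span an ideal; because degree \<open>d\<close> has
  at least \<open>h d\<close> monomials, exactly \<open>h d\<close> of them are in this ideal.
\<close>

lemma lexicographic_ideal_exists:
  fixes h :: "nat \<Rightarrow> nat"
  assumes q: "q > 0"
    and X: "\<And>d k. h d \<le> h (d + k)"
    and Y: "\<And>d. h d > 0 \<Longrightarrow> Suc (h d) \<le> h (d + q)"
    and bound: "\<And>d. h d \<le> card (exps_of_degree q d)"
  shows "\<exists>L :: 'k::field bipoly set. lexicographic_ideal q L \<and> (\<forall>d. card (leading_exps q L d) = h d)"
proof -
  define M where "M = {m. snd m < h (wdeg q m)}"
  define L where "L = {f :: 'k bipoly. Poly_Mapping.keys f \<subseteq> M}"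
  have Yk: "(a, b + k) \<in> M" if "(a, b) \<in> M" for a b k
  proof (induction k)
    case (Suc k)
    have "b + k < h (a + q * (b + k))" using Suc by (simp add: M_def wdeg_def)
    then show ?case
      using Y[of "a + q * (b + k)"] by (simp add: M_def wdeg_def algebra_simps)
  qed (use that in simp)
  have Xk: "(a + k, b) \<in> M" if "(a, b) \<in> M" for a b k
    using that X[of "a + q * b" k] by (simp add: M_def wdeg_def algebra_simps)
  have up: "n + m \<in> M" if "m \<in> M" for m n
    using Yk[OF Xk, of "fst m" "snd m" "fst n" "snd n"] that
    by (simp add: plus_prod_def add.commute)
  have "L = R.span (mono_XY ` M)" unfolding L_def by (rule R_span_mono_XY[OF up, symmetric])
  then have mon: "monomial_ideal L" by (auto simp: monomial_ideal_def)
  have part: "L \<inter> graded_part q d = KV.span (mono_XY ` (M \<inter> exps_of_degree q d))" for d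
    by (auto simp: L_def graded_part_eq KV_span_mono_XY)
  have lex: "lexsegment q d (M \<inter> exps_of_degree q d)" for d
  proof -
    have "v \<in> M" if "u \<in> M" "fst v > fst u" "wdeg q v = wdeg q u" for u v
    proof -
      have "q * snd v \<le> q * snd u" using that(2,3) unfolding wdeg_def by linarith
      \<comment> \<open>In a fixed degree, a larger exponent of \<open>X\<close> means a smaller exponent of \<open>Y\<close>.\<close>
      then have "snd v \<le> snd u" using q by (simp only: mult_le_cancel1)
      then show ?thesis using that(1,3) by (simp add: M_def)
    qed
    then show ?thesis
      unfolding lexsegment_def lex_greater_def exps_of_degree_def by fastforce
  qed
  have "card (leading_exps q L d) = h d" for d
  proof -
    have "h d \<le> Suc (d div q)"
      using bound[of d] card_image[OF inj_on_snd_exps_of_degree, of q d]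
      by (simp add: snd_exps_of_degree[OF q])
    \<comment> \<open>The exponents of \<open>Y\<close> in degree \<open>d\<close> form an initial segment, so all of \<open>0, \<dots>, h d - 1\<close> occur.\<close>
    then have hd: "{..<h d} \<subseteq> snd ` exps_of_degree q d"
      by (auto simp: snd_exps_of_degree[OF q])
    have "snd ` (M \<inter> exps_of_degree q d) = {..<h d} \<inter> snd ` exps_of_degree q d"
      by (auto simp: M_def exps_of_degree_def)
    then have "snd ` (M \<inter> exps_of_degree q d) = {..<h d}" using hd by blast
    moreover have "card (snd ` (M \<inter> exps_of_degree q d)) = card (M \<inter> exps_of_degree q d)"
      by (intro card_image inj_on_subset[OF inj_on_snd_exps_of_degree[of q d]]) simp
    ultimately show ?thesis by (simp add: leading_exps_monomial_span[OF part])
  qed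
  moreover have "lexicographic_ideal q L" using mon part lex by (auto simp: lexicographic_ideal_def)
  ultimately show ?thesis by blast
qed

theorem theorem4p16:
  fixes I :: "'k::field_char_0 bipoly set" and q\<^sub>2 :: nat
  assumes "q\<^sub>2 > 1"
    and "homogeneous_ideal q\<^sub>2 I"
  shows "\<exists>!L :: 'k bipoly set. lexicographic_ideal q\<^sub>2 L \<and> (\<forall>t. hilbert q\<^sub>2 I t = hilbert q\<^sub>2 L t)"
proof -
  have q: "q\<^sub>2 > 0" using assms(1) by simp
  have I: "R.subspace I" using assms(2) by (simp add: homogeneous_ideal_def)
  have "\<exists>L :: 'k bipoly set. lexicographic_ideal q\<^sub>2 L
      \<and> (\<forall>d. card (leading_exps q\<^sub>2 L d) = card (leading_exps q\<^sub>2 I d))"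
  proof (rule lexicographic_ideal_exists[OF q])
    show "card (leading_exps q\<^sub>2 I d) \<le> card (leading_exps q\<^sub>2 I (d + k))" for d k
      by (rule card_leading_X[OF q I])
    show "Suc (card (leading_exps q\<^sub>2 I d)) \<le> card (leading_exps q\<^sub>2 I (d + q\<^sub>2))"
      if "card (leading_exps q\<^sub>2 I d) > 0" for d
      using that by (intro card_leading_Y[OF q I]) auto
    show "card (leading_exps q\<^sub>2 I d) \<le> card (exps_of_degree q\<^sub>2 d)" for d
      by (intro card_mono finite_exps_of_degree[OF q] leading_exps_subset)
  qed
  then obtain L :: "'k bipoly set" where L: "lexicographic_ideal q\<^sub>2 L"
    and card: "\<And>d. card (leading_exps q\<^sub>2 L d) = card (leading_exps q\<^sub>2 I d)" by blast
  have "R.subspace L" using L by (auto simp: lexicographic_ideal_def intro: monomial_ideal_subspace)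
  then have "hilbert q\<^sub>2 I t = hilbert q\<^sub>2 L t" for t
    using hilbert_plus_card_leading[OF q I, of t] hilbert_plus_card_leading[OF q, of L t] card[of t]
    by simp
  then show ?thesis using L lexicographic_ideal_unique[OF q] by (intro ex1I[of _ L]) auto
qed

end
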